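(* Let $n\in\mathbb{N}$ and $A\in\mathrm{GL}(n,\mathbb{C})$. Then the linear diffeomorphism $f:\mathbb{C}^n\to\mathbb{C}^n$, $f(x)=Ax$, is complex-analytically $(n,0)$-integrable.
   Context: Definition. A diffeomorphism $f$ of an $n$-dimensional manifold is called $(m,n-m)$-integrable if there exist $m$ vector fields $X_1,\ldots,X_m$ and $n-m$ scalar-valued functions $F_1,\ldots,F_{n-m}$ such that: (i) $X_1,\dots,X_m$ are linearly independent almost everywhere and commute with each other (vanishing Lie brackets); (ii) $\mathrm{d}F_1,\ldots,\mathrm{d}F_{n-m}$ are linearly independent almost everywhere and $F_1,\ldots,F_{n-m}$ are first integrals of $X_1,\dots,X_m$; (iii) the flow $\varphi_j^t$ of $X_j$ satisfies $f\circ\varphi_j^t=\varphi_j^t\circ f$ for all $t\in\mathbb{R}$ and all $j$, and $F_j\circ f=F_j$ for all $j$. For $f$ on $\mathbb{C}^n$, "complex-analytically $(n,0)$-integrable" means that this holds with $m=n$ in the holomorphic category: there exist $n$ holomorphic vector fields $v_1,\dots,v_n:\mathbb{C}^n\to\mathbb{C}^n$ which are linearly independent over $\mathbb{C}$ almost everywhere, satisfy $[v_j,v_k](x)=\mathrm{D}v_k(x)v_j(x)-\mathrm{D}v_j(x)v_k(x)\equiv 0$ for all $j,k$, and whose flows $\varphi_j^t$ (defined for all $t\in\mathbb{R}$) satisfy $f\circ\varphi_j^t=\varphi_j^t\circ f$ for all $t\in\mathbb{R}$; no first integrals are required. *)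

theory Defs
  imports "HOL-Analysis.Analysis"
begin

(* The library's holomorphic_on covers only functions of one complex variable.  On C^n we
   require complex Frechet differentiability everywhere: the real Frechet derivative, which
   is what has_derivative provides, has to be complex linear, i.e. given by a complex matrix. *)
definition holomorphic_map :: "(complex ^ 'n \<Rightarrow> complex ^ 'n) \<Rightarrow> bool" where
  "holomorphic_map v \<longleftrightarrow>
     (\<forall>x. \<exists>J :: complex ^ 'n ^ 'n. (v has_derivative (\<lambda>h. J *v h)) (at x))"

definition biholomorphic_map :: "(complex ^ 'n \<Rightarrow> complex ^ 'n) \<Rightarrow> bool" where
  "biholomorphic_map f \<longleftrightarrow> bij f \<and> holomorphic_map f \<and> holomorphic_map (inv f)"

definition lie_bracket ::
  "(complex ^ 'n \<Rightarrow> complex ^ 'n) \<Rightarrow> (complex ^ 'n \<Rightarrow> complex ^ 'n) \<Rightarrow> complex ^ 'n \<Rightarrow> complex ^ 'n" where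
  "lie_bracket v w x =
     frechet_derivative w (at x) (v x) - frechet_derivative v (at x) (w x)"

(* For holomorphic, hence locally Lipschitz, v the function \<phi> is uniquely determined by v. *)
definition is_global_flow ::
  "(complex ^ 'n \<Rightarrow> complex ^ 'n) \<Rightarrow> (real \<Rightarrow> complex ^ 'n \<Rightarrow> complex ^ 'n) \<Rightarrow> bool" where
  "is_global_flow v \<phi> \<longleftrightarrow>
     (\<forall>x. \<phi> 0 x = x \<and>
       (\<forall>t. ((\<lambda>s. \<phi> s x) has_vector_derivative v (\<phi> t x)) (at t)))"

(* The n vector fields are indexed by the type 'n itself, n = CARD('n).  Injectivity
   is needed because vec.independent (linear independence over the scalar field of
   *s, here the complex numbers) speaks about sets rather than families.  The measure is
   Lebesgue measure on C^n = R^(2n). *)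
definition complex_analytically_n_0_integrable :: "(complex ^ 'n \<Rightarrow> complex ^ 'n) \<Rightarrow> bool" where
  "complex_analytically_n_0_integrable f \<longleftrightarrow>
     biholomorphic_map f \<and>
     (\<exists>v :: 'n \<Rightarrow> complex ^ 'n \<Rightarrow> complex ^ 'n.
        (\<forall>j. holomorphic_map (v j)) \<and>
        (AE x in lebesgue. inj (\<lambda>j. v j x) \<and> vec.independent (range (\<lambda>j. v j x))) \<and>
        (\<forall>j k x. lie_bracket (v j) (v k) x = 0) \<and>
        (\<forall>j. \<exists>\<phi>. is_global_flow (v j) \<phi> \<and> (\<forall>t. f \<circ> \<phi> t = \<phi> t \<circ> f)))"

end

(* By the Jordan normal form, A is conjugate to a direct sum of Jordan blocks lam I + N.  The powers
   of the nilpotent parts of the single blocks, extended by zero to the other blocks, are n matrices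
   that commute with each other and with the normal form.  Their conjugates B are the linear vector
   fields x |-> B x: the brackets are commutators, the flows are the exponentials exp(t B), and
   B_1 x, ..., B_n x are linearly independent unless one of the finitely many coordinates of x with
   respect to the Jordan basis vanishes. *)

theory Submission
  imports Defs "Jordan_Normal_Form.Jordan_Normal_Form_Existence"
begin

no_notation Matrix.vec_index (infixl \<open>$\<close> 100)
hide_const (open) Matrix.mat
hide_fact (open) Matrix.vec_eq_iff Matrix.mat_def

section \<open>Linear vector fields\<close>

lemma holomorphic_map_linear: "holomorphic_map ((*v) B)"
  unfolding holomorphic_map_def
  by (blast intro: bounded_linear_imp_has_derivative matrix_vector_mul_bounded_linear)

lemma biholomorphic_map_linear:
  assumes "invertible A"
  shows "biholomorphic_map ((*v) A)"
proof -
  obtain A' where A': "A ** A' = mat 1" "A' ** A = mat 1"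
    using assms unfolding invertible_def by blast
  have l: "(*v) A' \<circ> (*v) A = id" and r: "(*v) A \<circ> (*v) A' = id"
    using A' by (auto simp: fun_eq_iff matrix_vector_mul_assoc)
  show ?thesis
    unfolding biholomorphic_map_def inv_unique_comp[OF r l]
    using o_bij[OF l r] by (simp add: holomorphic_map_linear)
qed

lemma lie_bracket_linear:
  fixes B C :: "complex ^ 'n ^ 'n"
  assumes "B ** C = C ** B"
  shows "lie_bracket ((*v) B) ((*v) C) x = 0"
proof -
  have "frechet_derivative ((*v) M) (at y) = (*v) M" for M :: "complex^'n^'n" and y
    by (metis frechet_derivative_at bounded_linear_imp_has_derivative matrix_vector_mul_bounded_linear)
  then show ?thesis
    unfolding lie_bracket_def by (simp add: matrix_vector_mul_assoc assms)
qed

text \<open>Limits in a finite product are componentwise, so the normalised remainder tends to zero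
  as soon as each of its components does.\<close>

lemma has_vector_derivative_vec_componentwise:
  fixes f :: "real \<Rightarrow> 'a::real_normed_vector ^ 'n"
  assumes "\<And>i. ((\<lambda>s. f s $ i) has_vector_derivative f' $ i) (at t)"
  shows "(f has_vector_derivative f') (at t)"
proof -
  have "((\<lambda>s. (f s - f t - (s - t) *\<^sub>R f') /\<^sub>R \<bar>s - t\<bar>) \<longlongrightarrow> 0) (at t)"
    using assms by (intro vec_tendstoI)
      (simp add: has_vector_derivative_def has_derivative_at_within)
  then show ?thesis
    by (simp add: has_vector_derivative_def has_derivative_at_within bounded_linear_scaleR_left)
qed

text \<open>The flow is exp(tB), built from one power series per component. It is chosen before
  \<open>M\<close>, so a single flow serves all matrices commuting with \<open>B\<close>.\<close>

lemma linear_field_has_commuting_flow: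
  fixes B :: "complex ^ 'n ^ 'n"
  obtains \<phi> where "is_global_flow ((*v) B) \<phi>"
    and "\<And>M t. M ** B = B ** M \<Longrightarrow> (*v) M \<circ> \<phi> t = \<phi> t \<circ> (*v) M"
proof -
  define p where "p k = ((*v) B) ^^ k" for k
  define c where "c x i k = p k x $ i / fact k" for x i k
  define \<phi> where "\<phi> t x = (\<chi> i. \<Sum>k. c x i k * complex_of_real t ^ k)" for t x
  obtain K where K: "K > 0" "\<And>x. norm (B *v x) \<le> norm x * K"
    using bounded_linear.pos_bounded[OF matrix_vector_mul_bounded_linear[of B]] by blast
  have p_Suc: "p (Suc k) x = B *v p k x" for k x
    by (simp add: p_def)
  have p_bound: "norm (p k x) \<le> norm x * K ^ k" for k x
  proof (induction k)
    case (Suc k)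
    have "norm (p (Suc k) x) \<le> norm (p k x) * K"
      using K(2) by (simp add: p_Suc)
    also have "\<dots> \<le> norm x * K ^ k * K"
      using Suc K(1) by (intro mult_right_mono) auto
    finally show ?case by (simp add: mult_ac)
  qed (simp add: p_def)
  have summ: "summable (\<lambda>k. c x i k * z ^ k)" for x i z
  proof (rule summable_comparison_test')
    \<comment> \<open>\<open>p_bound\<close> gives domination by an exponential series, hence
      convergence for every complex \<open>z\<close>.\<close>
    show "summable (\<lambda>k. norm x * (inverse (fact k) * (K * norm z) ^ k))"
      by (intro summable_mult summable_exp)
    fix k
    have "norm (p k x $ i) \<le> norm x * K ^ k"
      using p_bound[of k x] order_trans[OF Finite_Cartesian_Product.norm_nth_le] by blast
    then have "norm (p k x $ i) * (norm z ^ k / fact k) \<le> norm x * K ^ k * (norm z ^ k / fact k)"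
      by (rule mult_right_mono) simp
    then show "norm (c x i k * z ^ k) \<le> norm x * (inverse (fact k) * (K * norm z) ^ k)"
      by (simp add: c_def norm_mult norm_divide norm_power power_mult_distrib field_simps)
  qed
  have sums: "(\<lambda>k. c x i k * of_real t ^ k) sums (\<phi> t x $ i)" for x i t
    using summable_sums[OF summ] by (simp add: \<phi>_def)
  \<comment> \<open>A constant matrix passes through the series. The choice \<open>M = B\<close>
    serves the derivative, a commuting \<open>M\<close> the commutation.\<close>
  have lin: "(\<lambda>k. (M *v p k x) $ i / fact k * of_real t ^ k) sums ((M *v \<phi> t x) $ i)"
    for M :: "complex^'n^'n" and x i t
  proof -
    have "(\<lambda>k. \<Sum>j\<in>UNIV. M $ i $ j * (c x j k * of_real t ^ k)) sums
        (\<Sum>j\<in>UNIV. M $ i $ j * \<phi> t x $ j)"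
      by (intro sums_sum sums_mult sums)
    moreover have "(\<Sum>j\<in>UNIV. M $ i $ j * (c x j k * of_real t ^ k)) =
        (M *v p k x) $ i / fact k * of_real t ^ k" for k
      unfolding matrix_vector_mult_def c_def sum_divide_distrib sum_distrib_right vec_lambda_beta
      by (rule sum.cong) simp_all
    ultimately show ?thesis
      by (simp add: matrix_vector_mult_def)
  qed
  have deriv: "((\<lambda>s. \<phi> s x) has_vector_derivative B *v \<phi> t x) (at t)" for x t
  proof (rule has_vector_derivative_vec_componentwise)
    fix i
    \<comment> \<open>The factor from termwise differentiation cancels in the factorial: (k+1)
      p(k+1) / (k+1)! = B p(k) / k!.\<close>
    have "diffs (c x i) = (\<lambda>k. (B *v p k x) $ i / fact k)"
      by (auto simp: diffs_def c_def p_Suc fun_eq_iff field_simps simp del: of_nat_Suc)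
    then have "(\<Sum>k. diffs (c x i) k * of_real t ^ k) = (B *v \<phi> t x) $ i"
      using sums_unique[OF lin] by metis
    then have "((\<lambda>z. \<Sum>k. c x i k * z ^ k) has_field_derivative (B *v \<phi> t x) $ i) (at (of_real t))"
      using termdiffs_strong_converges_everywhere[OF summ, of x i "of_real t"] by metis
    \<comment> \<open>The complex derivative at a real point restricts to the real line.\<close>
    from has_vector_derivative_real_field[OF this]
    show "((\<lambda>s. \<phi> s x $ i) has_vector_derivative (B *v \<phi> t x) $ i) (at t)"
      by (simp add: \<phi>_def)
  qed
  have init: "\<phi> 0 x = x" for x
  proof -
    have "(\<lambda>k. c x i k * 0 ^ k) sums (c x i 0)" for i
      by (rule powser_sums_zero)
    with sums[of x _ 0] have "\<phi> 0 x $ i = c x i 0" for i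
      using sums_unique2 by fastforce
    then show ?thesis by (simp add: vec_eq_iff c_def p_def)
  qed
  have comm: "M *v \<phi> t x = \<phi> t (M *v x)" if "M ** B = B ** M" for M t x
  proof -
    have "p k (M *v x) = M *v p k x" for k
      by (induction k) (simp_all add: p_Suc matrix_vector_mul_assoc that, simp add: p_def)
    then show ?thesis
      using sums[of "M *v x" _ t] lin[of M x _ t] sums_unique2
      by (fastforce simp: vec_eq_iff c_def)
  qed
  show ?thesis
  proof (rule that[of \<phi>])
    show "is_global_flow ((*v) B) \<phi>"
      by (simp add: is_global_flow_def init deriv)
  qed (auto simp: fun_eq_iff comm)
qed

section \<open>Linear independence\<close>

text \<open>Independence of the range alone would allow repetitions. If \<open>v j = v k\<close>
  with j and k distinct, their difference is a nontrivial relation of the family.\<close>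

lemma inj_independent_familyI:
  fixes v :: "'n::finite \<Rightarrow> 'a::field ^ 'm"
  assumes "\<And>c j. (\<Sum>j\<in>UNIV. c j *s v j) = 0 \<Longrightarrow> c j = 0"
  shows "inj v \<and> vec.independent (range v)"
proof
  show inj: "inj v"
  proof (rule injI, rule ccontr)
    fix j k assume jk: "v j = v k" "j \<noteq> k"
    have "(\<Sum>i\<in>UNIV. ((if i = j then 1 else 0) - (if i = k then 1 else 0)) *s v i)
        = (\<Sum>i\<in>UNIV. if i = j then v i else 0) - (\<Sum>i\<in>UNIV. if i = k then v i else 0)"
      unfolding sum_subtractf[symmetric]
      by (rule sum.cong) (auto simp: vec.scale_left_diff_distrib)
    also have "\<dots> = 0" using jk by simp
    finally show False using assms[of "\<lambda>i. (if i = j then 1 else 0) - (if i = k then 1 else 0)" j] jk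
      by simp
  qed
  show "vec.independent (range v)"
  proof (rule vec.independent_if_scalars_zero)
    fix f x assume *: "(\<Sum>x\<in>range v. f x *s x) = 0" "x \<in> range v"
    then have "(\<Sum>j\<in>UNIV. f (v j) *s v j) = 0"
      by (simp add: sum.reindex[OF inj])
    from assms[OF this] *(2) show "f x = 0" by auto
  qed simp
qed

text \<open>Each coordinate of Qx is a nonzero complex linear form, and its kernel lies in the real
  hyperplane where its real part vanishes, a null set.\<close>

lemma AE_invertible_image_components_nonzero:
  fixes Q :: "complex ^ 'n ^ 'n"
  assumes "invertible Q"
  shows "AE x in lebesgue. \<forall>i. (Q *v x) $ i \<noteq> 0"
proof -
  have "AE x in lebesgue. (Q *v x) $ i \<noteq> 0" for i
  proof -
    \<comment> \<open>Conjugating row i makes the real inner product with \<open>a\<close> the real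
      part of the i-th coordinate.\<close>
    define a :: "complex ^ 'n" where "a = (\<chi> j. cnj (Q $ i $ j))"
    have "a \<noteq> 0"
    proof
      assume "a = 0"
      then have "Q $ i $ j = 0" for j
        by (simp add: a_def vec_eq_iff)
      then have "(Q *v x) $ i = 0" for x
        by (simp add: matrix_vector_mult_def)
      moreover obtain x where "Q *v x = axis i 1"
        using assms by (metis invertible_right_inverse matrix_right_invertible_surjective surjD)
      ultimately show False by (metis axis_nth zero_neq_one)
    qed
    then have "negligible {x. inner a x = 0}"
      by (intro negligible_hyperplane) simp
    moreover have "inner a x = Re ((Q *v x) $ i)" for x
      by (simp add: a_def inner_vec_def inner_complex_def matrix_vector_mult_def)
    then have "{x. (Q *v x) $ i = 0} \<subseteq> {x. inner a x = 0}" by auto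
    ultimately show ?thesis
      by (intro AE_I'[of "{x. inner a x = 0}"]) (auto simp: negligible_iff_null_sets)
  qed
  then have "AE x in lebesgue. \<forall>i\<in>UNIV. (Q *v x) $ i \<noteq> 0"
    by (intro AE_finite_allI) auto
  then show ?thesis by simp
qed


section \<open>Jordan normal form over an arbitrary finite index type\<close>

text \<open>Basis vectors are labelled by pairs: number of the Jordan block, position in the block.\<close>

definition jordan_entry :: "(nat \<Rightarrow> 'a::{zero,one}) \<Rightarrow> nat \<times> nat \<Rightarrow> nat \<times> nat \<Rightarrow> 'a" where
  "jordan_entry lam p q =
     (if fst p \<noteq> fst q then 0 else if snd p = snd q then lam (fst p)
      else if snd q = Suc (snd p) then 1 else 0)"

text \<open>The list holds sizes and eigenvalues of the blocks. The value at \<open>[]\<close> is a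
  dummy that only indices not below the total size reach.\<close>

fun jordan_position :: "(nat \<times> 'a) list \<Rightarrow> nat \<Rightarrow> nat \<times> nat" where
  "jordan_position [] i = (0, i)"
| "jordan_position ((n, a) # bs) i =
     (if i < n then (0, i) else apfst Suc (jordan_position bs (i - n)))"

text \<open>The inverse adds the total size of the preceding blocks to the position within the
  block.\<close>

lemma bij_betw_jordan_position:
  "bij_betw (jordan_position bs) {..<sum_list (map fst bs)}
     (SIGMA b:{..<length bs}. {..<fst (bs ! b)})"
proof (rule bij_betw_byWitness[where f' = "\<lambda>(b, k). sum_list (map fst (take b bs)) + k"])
  show "\<forall>i\<in>{..<sum_list (map fst bs)}.
      (case jordan_position bs i of (b, k) \<Rightarrow> sum_list (map fst (take b bs)) + k) = i"
  proof (induction bs)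
    case (Cons x bs)
    obtain n a where [simp]: "x = (n, a)" by force
    show ?case
    proof
      fix i assume i: "i \<in> {..<sum_list (map fst (x # bs))}"
      obtain b k where bk: "jordan_position bs (i - n) = (b, k)" by force
      have "n + sum_list (map fst (take b bs)) + k = i" if "\<not> i < n"
      proof -
        have "i - n \<in> {..<sum_list (map fst bs)}" using i that by auto
        from Cons.IH[rule_format, OF this] that show ?thesis by (simp add: bk)
      qed
      then show "(case jordan_position (x # bs) i of
          (b, k) \<Rightarrow> sum_list (map fst (take b (x # bs))) + k) = i"
        by (simp add: bk)
    qed
  qed simp
  show "\<forall>p\<in>SIGMA b:{..<length bs}. {..<fst (bs ! b)}.
      jordan_position bs (case p of (b, k) \<Rightarrow> sum_list (map fst (take b bs)) + k) = p"
  proof (induction bs)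
    case (Cons x bs)
    then show ?case
      by (cases x) (auto simp: less_Suc_eq_0_disj add.assoc)
  qed simp
  show "jordan_position bs ` {..<sum_list (map fst bs)} \<subseteq> (SIGMA b:{..<length bs}. {..<fst (bs ! b)})"
  proof (induction bs)
    case (Cons x bs)
    obtain n a where [simp]: "x = (n, a)" by force
    show ?case
    proof (rule image_subsetI)
      fix i assume i: "i \<in> {..<sum_list (map fst (x # bs))}"
      obtain b k where bk: "jordan_position bs (i - n) = (b, k)" by force
      have "b < length bs \<and> k < fst (bs ! b)" if "\<not> i < n"
      proof -
        have "i - n \<in> {..<sum_list (map fst bs)}" using i that by auto
        then have "jordan_position bs (i - n) \<in> (SIGMA b:{..<length bs}. {..<fst (bs ! b)})"
          using Cons.IH by blast
        then show ?thesis by (simp add: bk)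
      qed
      then show "jordan_position (x # bs) i \<in> (SIGMA b:{..<length (x # bs)}. {..<fst ((x # bs) ! b)})"
        by (simp add: bk)
    qed
  qed simp
  show "(\<lambda>(b, k). sum_list (map fst (take b bs)) + k) ` (SIGMA b:{..<length bs}. {..<fst (bs ! b)})
      \<subseteq> {..<sum_list (map fst bs)}"
  proof (induction bs)
    case (Cons x bs)
    then show ?case
      by (cases x) (fastforce simp: less_Suc_eq_0_disj)
  qed simp
qed

text \<open>Splitting off the first block leaves an entry inside it, a zero off-diagonal block, or
  an entry of the rest with both indices lowered by its size.\<close>

lemma jordan_matrix_entry:
  assumes "i < sum_list (map fst bs)" "j < sum_list (map fst bs)"
  shows "jordan_matrix bs $$ (i, j) =
    jordan_entry (\<lambda>b. snd (bs ! b)) (jordan_position bs i) (jordan_position bs j)"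
  using assms
proof (induction bs arbitrary: i j)
  case (Cons x bs)
  obtain n a where x: "x = (n, a)" by force
  show ?case
    using Cons.prems Cons.IH[of "i - n" "j - n"]
    by (auto simp: x jordan_matrix_Cons jordan_entry_def)
qed simp

text \<open>Complex characteristic polynomials split, so a Jordan form exists. The enumeration
  \<open>h\<close> carries it to the index type, as \<open>F\<close> preserves products and the
  identity.\<close>

lemma jordan_nf_vec:
  fixes A :: "complex ^ 'n ^ 'n"
  obtains P Q :: "complex ^ 'n ^ 'n" and g :: "'n \<Rightarrow> nat \<times> nat" and L m lam
  where "P ** Q = mat 1" "Q ** P = mat 1"
    and "A = P ** (\<chi> i j. jordan_entry lam (g i) (g j)) ** Q"
    and "bij_betw g UNIV (SIGMA b:{..<L}. {..<m b})"
proof -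
  let ?N = "CARD('n)"
  obtain h :: "'n \<Rightarrow> nat" where h: "bij_betw h UNIV {0..<?N}"
    using ex_bij_betw_finite_nat[of "UNIV :: 'n set"] by auto
  have h_less: "h i < ?N" for i
    using h by (auto simp: bij_betw_def)
  have inj_h: "inj h" using h by (simp add: bij_betw_def)
  define F :: "complex Matrix.mat \<Rightarrow> complex ^ 'n ^ 'n" where "F M = (\<chi> i j. M $$ (h i, h j))" for M
  have F_mult: "F (M * M') = F M ** F M'" if "M \<in> carrier_mat ?N ?N" "M' \<in> carrier_mat ?N ?N" for M M'
    using that h_less sum.reindex_bij_betw[OF h, of "\<lambda>k. M $$ (h i, k) * M' $$ (k, h j)" for i j]
    by (simp add: F_def matrix_matrix_mult_def vec_eq_iff scalar_prod_def)
  have F_one: "F (1\<^sub>m ?N) = mat 1"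
    using h_less inj_h by (auto simp: F_def mat_def vec_eq_iff inj_eq)
  define A' where "A' = Matrix.mat ?N ?N (\<lambda>(i, j). A $ inv_into UNIV h i $ inv_into UNIV h j)"
  have A': "A' \<in> carrier_mat ?N ?N" by (simp add: A'_def)
  have F_A': "F A' = A"
    using h_less inj_h by (simp add: F_def A'_def vec_eq_iff)
  obtain bs where "jordan_nf A' bs"
    using char_poly_factorized[OF A'] jordan_nf_exists[OF A'] by blast
  then obtain P Q where "similar_mat_wit A' (jordan_matrix bs) P Q"
    unfolding jordan_nf_def similar_mat_def by blast
  from similar_mat_witD[OF _ this, of ?N] A'
  have wit: "P * Q = 1\<^sub>m ?N" "Q * P = 1\<^sub>m ?N" "A' = P * jordan_matrix bs * Q"
    and carr: "jordan_matrix bs \<in> carrier_mat ?N ?N" "P \<in> carrier_mat ?N ?N" "Q \<in> carrier_mat ?N ?N"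
    by auto
  have N: "sum_list (map fst bs) = ?N"
    using carr(1) by auto
  have "bij_betw (jordan_position bs \<circ> h) UNIV (SIGMA b:{..<length bs}. {..<fst (bs ! b)})"
    using h bij_betw_jordan_position[of bs] by (auto simp: N atLeast0LessThan intro: bij_betw_trans)
  moreover have "F (jordan_matrix bs) =
      (\<chi> i j. jordan_entry (\<lambda>b. snd (bs ! b)) ((jordan_position bs \<circ> h) i) ((jordan_position bs \<circ> h) j))"
    using h_less by (simp add: F_def jordan_matrix_entry N)
  moreover have "F P ** F Q = mat 1" "F Q ** F P = mat 1"
    using wit carr by (simp_all flip: F_mult F_one)
  moreover have "A = F P ** F (jordan_matrix bs) ** F Q"
    using carr by (simp add: wit(3) flip: F_A' F_mult)
  ultimately show ?thesis
    using that by metis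
qed

section \<open>Shifts inside the Jordan blocks\<close>

text \<open>Labels of a Jordan basis with \<open>L\<close> blocks, block \<open>b\<close> having
  size \<open>m b\<close>.\<close>

locale block_indexing =
  fixes g :: "'n::finite \<Rightarrow> nat \<times> nat" and L :: nat and m :: "nat \<Rightarrow> nat"
  assumes bij_g: "bij_betw g UNIV (SIGMA b:{..<L}. {..<m b})"
begin

text \<open>Entries of a vector by block label, extended by zero to all labels.  With this extension
  the blocks act by plain translations of the position.\<close>

definition ext :: "'a::zero ^ 'n \<Rightarrow> nat \<Rightarrow> nat \<Rightarrow> 'a" where
  "ext y b k = (if b < L \<and> k < m b then y $ inv_into UNIV g (b, k) else 0)"

text \<open>The \<open>d\<close>-th power of the nilpotent part of block \<open>c\<close>, zero on
  the other blocks; \<open>d = 0\<close> gives the projection onto the block.\<close>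

definition shift :: "nat \<Rightarrow> nat \<Rightarrow> 'a::zero_neq_one ^ 'n ^ 'n" where
  "shift c d = (\<chi> i j. if fst (g i) = c \<and> g j = (c, snd (g i) + d) then 1 else 0)"

definition jordan :: "(nat \<Rightarrow> 'a::zero_neq_one) \<Rightarrow> 'a ^ 'n ^ 'n" where
  "jordan lam = (\<chi> i j. jordan_entry lam (g i) (g j))"

lemma g_bounds: "fst (g i) < L" "snd (g i) < m (fst (g i))"
proof -
  have "g i \<in> (SIGMA b:{..<L}. {..<m b})"
    using bij_g by (auto simp: bij_betw_def)
  then show "fst (g i) < L" "snd (g i) < m (fst (g i))" by auto
qed

lemma inj_g: "inj g"
  using bij_g by (simp add: bij_betw_def)

lemma g_inv: "b < L \<Longrightarrow> k < m b \<Longrightarrow> g (inv_into UNIV g (b, k)) = (b, k)"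
  using bij_g by (intro f_inv_into_f) (auto simp: bij_betw_def)

lemma ext_g: "ext y (fst (g i)) (snd (g i)) = y $ i"
  by (simp add: ext_def g_bounds inj_g)

lemma vec_eq_if_ext_eq: "(\<And>b k. ext x b k = ext y b k) \<Longrightarrow> x = y"
  by (metis ext_g vec_eq_iff)

lemma sum_at_label:
  fixes y :: "'a::comm_monoid_add ^ 'n"
  shows "(\<Sum>j\<in>UNIV. if g j = (b, k) then y $ j else 0) = ext y b k"
proof (cases "b < L \<and> k < m b")
  case True
  then have "g j = (b, k) \<longleftrightarrow> j = inv_into UNIV g (b, k)" for j
    using g_inv inj_g by (metis inv_into_f_f UNIV_I)
  with True show ?thesis by (simp add: ext_def)
next
  case False
  then have "g j \<noteq> (b, k)" for j
    using g_bounds[of j] by auto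
  with False show ?thesis by (auto simp: ext_def)
qed

lemma shift_nth:
  fixes y :: "'a::comm_semiring_1 ^ 'n"
  shows "(shift c d *v y) $ i = (if fst (g i) = c then ext y c (snd (g i) + d) else 0)"
proof -
  have "(shift c d *v y) $ i =
      (if fst (g i) = c then (\<Sum>j\<in>UNIV. if g j = (c, snd (g i) + d) then y $ j else 0) else 0)"
    by (auto simp: shift_def matrix_vector_mult_def intro!: sum.cong)
  then show ?thesis by (simp only: sum_at_label)
qed

text \<open>For labels out of range both sides vanish, since \<open>k + d\<close> is then out of
  range too.\<close>

lemma ext_shift:
  fixes y :: "'a::comm_semiring_1 ^ 'n"
  shows "ext (shift c d *v y) b k = (if b = c then ext y b (k + d) else 0)"
proof (cases "b < L \<and> k < m b")
  case True
  then show ?thesis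
    by (cases "b = c") (simp_all add: ext_def[of "shift c d *v y"] shift_nth g_inv)
qed (auto simp: ext_def)

text \<open>At the last position of a block the second summand is zero, in line with the missing
  superdiagonal entry.\<close>

lemma ext_jordan:
  fixes y :: "'a::comm_semiring_1 ^ 'n"
  shows "ext (jordan lam *v y) b k = lam b * ext y b k + ext y b (Suc k)"
proof (cases "b < L \<and> k < m b")
  case True
  define i where "i = inv_into UNIV g (b, k)"
  have gi: "g i = (b, k)" using True by (simp add: i_def g_inv)
  have "(jordan lam *v y) $ i = (\<Sum>j\<in>UNIV. jordan_entry lam (b, k) (g j) * y $ j)"
    by (simp add: jordan_def matrix_vector_mult_def gi)
  also have "\<dots> = (\<Sum>j\<in>UNIV. lam b * (if g j = (b, k) then y $ j else 0) +
      (if g j = (b, Suc k) then y $ j else 0))"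
    by (rule sum.cong) (auto simp: jordan_entry_def prod_eq_iff)
  also have "\<dots> = lam b * ext y b k + ext y b (Suc k)"
    by (simp only: sum.distrib sum_distrib_left[symmetric] sum_at_label)
  finally show ?thesis
    using True by (simp add: ext_def[of "jordan lam *v y"] i_def)
qed (auto simp: ext_def)

lemma shift_commute:
  "shift c d ** shift c' d' = (shift c' d' ** shift c d :: 'a::comm_semiring_1 ^ 'n ^ 'n)"
proof -
  have "shift c d *v (shift c' d' *v y) = shift c' d' *v (shift c d *v (y :: 'a ^ 'n))" for y
    by (rule vec_eq_if_ext_eq) (simp add: ext_shift add_ac)
  then show ?thesis by (simp add: matrix_eq matrix_vector_mul_assoc)
qed

text \<open>The eigenvalue is constant on a block and translations commute.\<close>

lemma jordan_shift_commute:
  "jordan lam ** shift c d = (shift c d ** jordan lam :: 'a::comm_semiring_1 ^ 'n ^ 'n)"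
proof -
  have "jordan lam *v (shift c d *v y) = shift c d *v (jordan lam *v (y :: 'a ^ 'n))" for y
    by (rule vec_eq_if_ext_eq) (simp add: ext_shift ext_jordan)
  then show ?thesis by (simp add: matrix_eq matrix_vector_mul_assoc)
qed

text \<open>Within a block the exponents run through 0, ..., \<open>m b - 1\<close> in reverse order
  of position, so each power gets exactly one label.\<close>

definition label_shift :: "'n \<Rightarrow> 'a::zero_neq_one ^ 'n ^ 'n" where
  "label_shift p = shift (fst (g p)) (m (fst (g p)) - 1 - snd (g p))"

text \<open>The shift attached to a label moves the last entry of its block, which is nonzero, to that
  label and only fills labels before it, so the system is triangular within each block.\<close>

lemma label_shift_independent:
  fixes y :: "'a::field ^ 'n"
  assumes nz: "\<And>i. y $ i \<noteq> 0"
    and sum0: "(\<Sum>p\<in>UNIV. c p *s (label_shift p *v y)) = 0"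
  shows "c p = 0"
\<comment> \<open>Coefficients are eliminated from the last position of each block
  backwards.\<close>
proof (induction p rule: measure_induct_rule[where f = "\<lambda>p. m (fst (g p)) - snd (g p)"])
  case (less p)
  obtain b k where gp: "g p = (b, k)" by force
  have bk: "b < L" "k < m b" using g_bounds[of p] gp by auto
  have zero: "c q * (label_shift q *v y) $ p = 0" if "q \<noteq> p" for q
  proof (cases "fst (g q) = b")
    case True
    then obtain l where gq: "g q = (b, l)" by (metis prod.collapse)
    have "l < m b" using g_bounds[of q] gq by auto
    have "l \<noteq> k" using that gp gq inj_g by (metis injD)
    then consider "k < l" | "l < k" by linarith
    then show ?thesis
    proof cases
      case 1
      then have "c q = 0" using less.IH[of q] gp gq \<open>l < m b\<close> by auto
      then show ?thesis by simp
    next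
      \<comment> \<open>The translated position k + (m b - 1 - l) lies beyond the block.\<close>
      case 2
      then show ?thesis
        using bk \<open>l < m b\<close> by (simp add: label_shift_def shift_nth gp gq ext_def)
    qed
  qed (simp add: label_shift_def shift_nth gp)
  have "0 = (\<Sum>q\<in>UNIV. c q *s (label_shift q *v y)) $ p"
    by (simp add: sum0)
  also have "\<dots> = (\<Sum>q\<in>UNIV. c q * (label_shift q *v y) $ p)"
    by simp
  also have "\<dots> = (\<Sum>q\<in>{p}. c q * (label_shift q *v y) $ p)"
    by (rule sum.mono_neutral_right) (use zero in auto)
  \<comment> \<open>On the diagonal the translated position is k + (m b - 1 - k) = m b - 1, the last
    one.\<close>
  also have "\<dots> = c p * ext y b (m b - 1)"
    using bk by (simp add: label_shift_def shift_nth gp)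
  finally show ?case
    using bk nz by (simp add: ext_def)
qed

end

section \<open>Transport of the shifts to the original coordinates\<close>

theorem proposition3p11:
  fixes A :: "complex ^ 'n ^ 'n"
  assumes "invertible A"
  shows "complex_analytically_n_0_integrable (\<lambda>x. A *v x)"
proof -
  obtain P Q :: "complex ^ 'n ^ 'n" and g :: "'n \<Rightarrow> nat \<times> nat" and L m lam
    where PQ: "P ** Q = mat 1" and QP: "Q ** P = mat 1"
      and A: "A = P ** (\<chi> i j. jordan_entry lam (g i) (g j)) ** Q"
      and g: "bij_betw g UNIV (SIGMA b:{..<L}. {..<m b})"
    by (rule jordan_nf_vec)
  interpret block_indexing g L m by unfold_locales (rule g)
  define conj where "conj M = P ** M ** Q" for M
  \<comment> \<open>Conjugation is multiplicative, so commutation of the shifts with each other and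
    with the Jordan form carries over to \<open>B\<close> and \<open>A\<close>.\<close>
  have conj_mult: "conj M ** conj M' = conj (M ** M')" for M M'
  proof -
    have "conj M ** conj M' = P ** M ** (Q ** P) ** M' ** Q"
      by (simp only: conj_def matrix_mul_assoc)
    then show ?thesis by (simp add: QP conj_def matrix_mul_assoc)
  qed
  have A: "A = conj (jordan lam)" by (simp add: A conj_def jordan_def)
  define B :: "'n \<Rightarrow> complex ^ 'n ^ 'n" where "B p = conj (label_shift p)" for p
  have BB: "B p ** B q = B q ** B p" for p q
    by (simp add: B_def conj_mult label_shift_def shift_commute)
  have AB: "A ** B p = B p ** A" for p
    by (simp add: B_def A conj_mult label_shift_def jordan_shift_commute)
  have indep: "inj (\<lambda>p. B p *v x) \<and> vec.independent (range (\<lambda>p. B p *v x))"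
    if "\<forall>i. (Q *v x) $ i \<noteq> 0" for x
  proof (rule inj_independent_familyI)
    fix c p assume *: "(\<Sum>p\<in>UNIV. c p *s (B p *v x)) = 0"
    \<comment> \<open>\<open>Q\<close> intertwines \<open>B q\<close> with the shift, turning a
      relation at x into one at Qx, whose entries are all nonzero.\<close>
    have "label_shift q *v (Q *v x) = Q *v (B q *v x)" for q
      by (simp add: B_def conj_def matrix_vector_mul_assoc matrix_mul_assoc QP)
    then have "(\<Sum>p\<in>UNIV. c p *s (label_shift p *v (Q *v x))) = Q *v (\<Sum>p\<in>UNIV. c p *s (B p *v x))"
      by (simp add: vec.sum vector_scalar_commute)
    with * have "(\<Sum>p\<in>UNIV. c p *s (label_shift p *v (Q *v x))) = 0"
      by simp
    with that show "c p = 0"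
      by (intro label_shift_independent[of "Q *v x"]) auto
  qed
  have "AE x in lebesgue. inj (\<lambda>p. B p *v x) \<and> vec.independent (range (\<lambda>p. B p *v x))"
  proof (rule eventually_mono[OF AE_invertible_image_components_nonzero[of Q] indep])
    show "invertible Q" using PQ QP unfolding invertible_def by blast
  qed
  moreover have "\<exists>\<phi>. is_global_flow ((*v) (B p)) \<phi> \<and> (\<forall>t. (*v) A \<circ> \<phi> t = \<phi> t \<circ> (*v) A)" for p
    using linear_field_has_commuting_flow[of "B p"] AB by metis
  ultimately show ?thesis
    unfolding complex_analytically_n_0_integrable_def
    using assms BB
    by (intro conjI exI[of _ "\<lambda>p. (*v) (B p)"])
      (simp_all add: biholomorphic_map_linear holomorphic_map_linear lie_bracket_linear)
qed

end
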